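(* Let $\mathcal{H}$ be a real Hilbert space, let $\alpha\in(0,1/2]$, and let $T:\mathcal{H}\to\mathcal{H}$ be an $\alpha$-averaged nonexpansive operator with $\mathrm{Fix}(T)\neq\varnothing$. Let $t\in(0,1)$, and let $\{x^k\}_{k\in\mathbb{N}}$ be a sequence generated by the TKMA iteration with operator $T$, parameter $t$ and starting point $x^0\in\mathcal{H}$, with associated momentum parameters $\{\theta_k\}$; assume $Tx^k\neq x^k$ for all $k\in\mathbb{N}$. If $\sum_{k=0}^{\infty}|\theta_{k+1}-\theta_k|<+\infty$, then $$\|x^{k+1}-x^k\|=o\left(\frac{1}{\sqrt{k}}\right)\quad\text{as } k\to\infty.$$
   Context: $\mathcal{I}$ denotes the identity operator on $\mathcal{H}$, and $\mathrm{Fix}(T)=\{x\in\mathcal{H}: Tx=x\}$. An operator $\mathcal{N}:\mathcal{H}\to\mathcal{H}$ is nonexpansive if $\|\mathcal{N}x-\mathcal{N}y\|\le\|x-y\|$ for all $x,y\in\mathcal{H}$. For $\alpha\in(0,1)$, $T$ is $\alpha$-averaged nonexpansive if there is a nonexpansive $\mathcal{N}:\mathcal{H}\to\mathcal{H}$ with $T=(1-\alpha)\mathcal{I}+\alpha\mathcal{N}$. For $\theta\in\mathbb{R}$, $T^{\theta}:=T+\theta(T-\mathcal{I})$; $T^2:=T\circ T$. TKMA iteration: given $t\in(0,1)$ and $x^0\in\mathcal{H}$, $$x^{k+1}=(1-t)T^2x^k+tT^{\theta_k}x^k,\qquad \theta_k:=\frac{-\langle Tx^k-x^k,\,Tx^k-T^2x^k\rangle}{\|Tx^k-x^k\|^2},\qquad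 k\in\mathbb{N}=\{0,1,2,\dots\}.$$ *)

theory Defs
  imports "HOL-Analysis.Analysis" "HOL-Library.Landau_Symbols"
begin

definition Fix :: "('a \<Rightarrow> 'a) \<Rightarrow> 'a set" where
  "Fix T = {x. T x = x}"

definition nonexpansive :: "('a::real_normed_vector \<Rightarrow> 'a) \<Rightarrow> bool" where
  "nonexpansive N \<longleftrightarrow> (\<forall>x y. norm (N x - N y) \<le> norm (x - y))"

definition averaged_nonexpansive :: "real \<Rightarrow> ('a::real_normed_vector \<Rightarrow> 'a) \<Rightarrow> bool" where
  "averaged_nonexpansive \<alpha> T \<longleftrightarrow> 0 < \<alpha> \<and> \<alpha> < 1 \<and>
     (\<exists>N. nonexpansive N \<and> T = (\<lambda>x. (1 - \<alpha>) *\<^sub>R x + \<alpha> *\<^sub>R N x))"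

text \<open>The operator \<open>T\<close> with superscript \<open>\<theta>\<close>, that is \<open>T + \<theta> (T - I)\<close>.\<close>

definition momentum_op :: "('a::real_vector \<Rightarrow> 'a) \<Rightarrow> real \<Rightarrow> 'a \<Rightarrow> 'a" where
  "momentum_op T \<theta> x = T x + \<theta> *\<^sub>R (T x - x)"

text \<open>The momentum parameter at a point \<open>x\<close>; it is meaningful only if \<open>T x \<noteq> x\<close>
  (otherwise the quotient is \<open>0\<close> by the convention for division by zero).\<close>

definition tkma_theta :: "('a::real_inner \<Rightarrow> 'a) \<Rightarrow> 'a \<Rightarrow> real" where
  "tkma_theta T x = - inner (T x - x) (T x - (T \<circ> T) x) / (norm (T x - x))\<^sup>2"

definition tkma_iteration ::
  "('a::real_inner \<Rightarrow> 'a) \<Rightarrow> real \<Rightarrow> 'a \<Rightarrow> (nat \<Rightarrow> 'a) \<Rightarrow> (nat \<Rightarrow> real) \<Rightarrow> bool" where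
  "tkma_iteration T t x0 x \<theta> \<longleftrightarrow> x 0 = x0 \<and>
     (\<forall>k. \<theta> k = tkma_theta T (x k) \<and>
          x (Suc k) = (1 - t) *\<^sub>R (T \<circ> T) (x k) + t *\<^sub>R momentum_op T (\<theta> k) (x k))"

end

theory Submission
  imports Defs
begin

text \<open>
  Write \<open>r\<^sub>k = T x\<^sub>k - x\<^sub>k\<close> and \<open>d\<^sub>k = \<parallel>x\<^sub>k\<^sub>+\<^sub>1 - x\<^sub>k\<parallel>\<close>. The rate follows from two facts about
  \<open>d\<^sub>k\<^sup>2\<close>: it is summable, and it is decreasing up to a bounded factor. A summable sequence
  that is decreasing up to a bounded factor is \<open>o(1/k)\<close>, because the second half of the
  first \<open>k\<close> terms already contributes a multiple of \<open>k d\<^sub>k\<^sup>2\<close> to a vanishing tail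
  (\<open>summable_quasi_decreasing_imp_tendsto\<close>).

  Both facts come from firm nonexpansiveness, which is what averagedness with constant at
  most \<open>1/2\<close> gives. It forces \<open>0 \<le> \<theta>\<^sub>k \<le> 1\<close>, since \<open>\<theta>\<^sub>k \<parallel>r\<^sub>k\<parallel>\<^sup>2\<close> is the inner product of
  \<open>r\<^sub>k\<close> with the next residual \<open>T\<^sup>2 x\<^sub>k - T x\<^sub>k\<close>. For such parameters every operator
  \<open>S\<^sub>\<theta> = (1 - t) T\<^sup>2 + t T\<^sup>\<theta>\<close> is nonexpansive, and a step of it decreases the squared
  distance to a fixed point by at least \<open>(1 - t) \<parallel>r\<parallel>\<^sup>2\<close>; telescoping gives
  \<open>\<Sum> \<parallel>r\<^sub>k\<parallel>\<^sup>2 < \<infinity>\<close>. Since the two residuals have a nonnegative inner product,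
  \<open>\<parallel>r\<^sub>k\<parallel> \<le> d\<^sub>k \<le> 2 \<parallel>r\<^sub>k\<parallel>\<close>; the upper bound transfers the summability to \<open>d\<^sub>k\<^sup>2\<close>.
  Finally \<open>x\<^sub>k\<^sub>+\<^sub>2 - x\<^sub>k\<^sub>+\<^sub>1\<close> differs from \<open>S\<^sub>\<theta> x\<^sub>k\<^sub>+\<^sub>1 - S\<^sub>\<theta> x\<^sub>k\<close> with \<open>\<theta> = \<theta>\<^sub>k\<^sub>+\<^sub>1\<close>
  only by \<open>t (\<theta>\<^sub>k\<^sub>+\<^sub>1 - \<theta>\<^sub>k) r\<^sub>k\<close>, so the lower bound gives
  \<open>d\<^sub>k\<^sub>+\<^sub>1 \<le> (1 + \<bar>\<theta>\<^sub>k\<^sub>+\<^sub>1 - \<theta>\<^sub>k\<bar>) d\<^sub>k\<close>, and the product of these factors is bounded because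
  the variation of \<open>\<theta>\<close> is finite.
\<close>

section \<open>Summable sequences that are almost decreasing\<close>

text \<open>All the terms with index between \<open>k/2\<close> and \<open>k\<close> are at least \<open>a k / C\<close>, so \<open>k * a k\<close> is
  bounded by a multiple of the tail of the series from \<open>k div 2\<close> on.\<close>

lemma summable_quasi_decreasing_imp_tendsto:
  fixes a :: "nat \<Rightarrow> real"
  assumes sum: "summable a" and nonneg: "\<And>n. 0 \<le> a n"
    and quasi: "\<And>m n. m \<le> n \<Longrightarrow> a n \<le> C * a m"
  shows "(\<lambda>k. real k * a k) \<longlonglongrightarrow> 0"
proof -
  define tail where "tail m = (\<Sum>i. a (i + m))" for m
  have bound: "real k * a k \<le> 2 * C * tail (k div 2)" for k
  proof -
    have "real (k - k div 2) * a k = (\<Sum>i<k - k div 2. a k)" by simp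
    also have "\<dots> \<le> (\<Sum>i<k - k div 2. C * a (i + k div 2))"
      by (intro sum_mono quasi) auto
    also have "\<dots> = C * (\<Sum>i<k - k div 2. a (i + k div 2))"
      by (simp add: sum_distrib_left)
    finally have half: "real (k - k div 2) * a k \<le> C * (\<Sum>i<k - k div 2. a (i + k div 2))" .
    have part: "(\<Sum>i<k - k div 2. a (i + k div 2)) \<le> tail (k div 2)"
      unfolding tail_def using sum nonneg by (intro sum_le_suminf) auto
    have "real k \<le> 2 * real (k - k div 2)" by linarith
    then have "real k * a k \<le> 2 * real (k - k div 2) * a k"
      by (intro mult_right_mono nonneg)
    then have "real k * a k \<le> 2 * (real (k - k div 2) * a k)"
      by (simp only: mult.assoc)
    also have "\<dots> \<le> 2 * (C * tail (k div 2))"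
    proof (cases "C \<ge> 0")
      case True
      then show ?thesis using half mult_left_mono[OF part True] by linarith
    next
      case False
      \<comment> \<open>A negative \<open>C\<close> is only possible for the zero sequence.\<close>
      have "a n = 0" for n
        using quasi[of n n] mult_nonpos_nonneg[of C "a n"] nonneg[of n] False by simp
      then show ?thesis by (simp add: tail_def)
    qed
    finally show ?thesis by simp
  qed
  have "tail \<longlonglongrightarrow> 0"
    unfolding tail_def using suminf_exist_split2[OF sum] .
  moreover have "filterlim (\<lambda>k::nat. k div 2) at_top at_top"
  proof (unfold filterlim_at_top, intro allI)
    fix Z :: nat
    show "\<forall>\<^sub>F k in sequentially. Z \<le> k div 2"
      by (rule eventually_sequentiallyI[of "2 * Z"]) simp
  qed
  ultimately have "(\<lambda>k. tail (k div 2)) \<longlonglongrightarrow> 0"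
    by (rule filterlim_compose)
  then have lim: "(\<lambda>k. 2 * C * tail (k div 2)) \<longlonglongrightarrow> 0"
    using tendsto_mult_right_zero by blast
  show ?thesis
    by (rule tendsto_sandwich[OF _ _ tendsto_const lim])
       (use bound nonneg in \<open>auto intro!: always_eventually\<close>)
qed

text \<open>The accumulated growth from \<open>m\<close> to \<open>n\<close> is at most
  \<open>\<Prod> (1 + \<epsilon> i) \<le> exp (\<Sum> \<epsilon> i)\<close>.\<close>

lemma quasi_decreasing_if_summable_growth:
  fixes d \<epsilon> :: "nat \<Rightarrow> real"
  assumes sum: "summable \<epsilon>" and nonneg: "\<And>n. 0 \<le> \<epsilon> n" "\<And>n. 0 \<le> d n"
    and growth: "\<And>n. d (Suc n) \<le> (1 + \<epsilon> n) * d n"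
    and "m \<le> n"
  shows "d n \<le> exp (suminf \<epsilon>) * d m"
proof -
  have "d n \<le> exp (\<Sum>i=m..<n. \<epsilon> i) * d m"
    using \<open>m \<le> n\<close>
  proof (induction n rule: dec_induct)
    case (step n)
    have "d (Suc n) \<le> (1 + \<epsilon> n) * d n" by (rule growth)
    also have "\<dots> \<le> exp (\<epsilon> n) * d n"
      by (intro mult_right_mono nonneg) simp
    also have "\<dots> \<le> exp (\<epsilon> n) * (exp (\<Sum>i=m..<n. \<epsilon> i) * d m)"
      by (intro mult_left_mono step.IH) simp
    finally show ?case
      using step.hyps by (simp add: exp_add mult_ac)
  qed simp
  also have "\<dots> \<le> exp (suminf \<epsilon>) * d m"
    using sum nonneg by (intro mult_right_mono) (auto intro!: sum_le_suminf)
  finally show ?thesis .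
qed

section \<open>Firmly nonexpansive operators\<close>

definition firmly_nonexpansive :: "('a::real_inner \<Rightarrow> 'a) \<Rightarrow> bool" where
  "firmly_nonexpansive T \<longleftrightarrow> (\<forall>x y. (norm (T x - T y))\<^sup>2 \<le> inner (T x - T y) (x - y))"

text \<open>With \<open>v = x - y\<close> and \<open>w = N x - N y\<close>, the gap between the two sides of firm
  nonexpansiveness is
  \<open>\<alpha> ((1 - \<alpha>) \<parallel>v\<parallel>\<^sup>2 - (1 - 2\<alpha>) \<langle>v, w\<rangle> - \<alpha> \<parallel>w\<parallel>\<^sup>2)\<close>. Since \<open>1 - 2\<alpha> \<ge> 0\<close>, both \<open>\<langle>v, w\<rangle>\<close> and
  \<open>\<parallel>w\<parallel>\<^sup>2\<close> may be replaced by \<open>\<parallel>v\<parallel>\<^sup>2\<close>, and then the coefficients cancel.\<close>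

lemma averaged_imp_firmly_nonexpansive:
  fixes T :: "'a::real_inner \<Rightarrow> 'a"
  assumes "averaged_nonexpansive \<alpha> T" and "\<alpha> \<le> 1 / 2"
  shows "firmly_nonexpansive T"
  unfolding firmly_nonexpansive_def
proof (intro allI)
  fix x y
  from assms obtain N where \<alpha>: "0 < \<alpha>" and N: "nonexpansive N"
    and T: "T = (\<lambda>x. (1 - \<alpha>) *\<^sub>R x + \<alpha> *\<^sub>R N x)"
    unfolding averaged_nonexpansive_def by blast
  define v w where "v = x - y" and "w = N x - N y"
  have u: "T x - T y = (1 - \<alpha>) *\<^sub>R v + \<alpha> *\<^sub>R w"
    unfolding T v_def w_def by (simp add: algebra_simps)
  have wv: "norm w \<le> norm v"
    using N unfolding nonexpansive_def v_def w_def by blast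
  then have ww: "inner w w \<le> inner v v"
    by (simp add: power_mono flip: power2_norm_eq_inner)
  have "inner v w \<le> norm v * norm w" by (rule norm_cauchy_schwarz)
  also have "\<dots> \<le> norm v * norm v" using wv by (intro mult_left_mono) auto
  finally have vw: "inner v w \<le> inner v v"
    by (simp add: power2_eq_square flip: power2_norm_eq_inner)
  have "(1 - 2 * \<alpha>) * inner v w \<le> (1 - 2 * \<alpha>) * inner v v"
    using vw assms(2) by (intro mult_left_mono) auto
  moreover have "\<alpha> * inner w w \<le> \<alpha> * inner v v"
    using ww \<alpha> by (intro mult_left_mono) auto
  ultimately have "0 \<le> (1 - \<alpha>) * inner v v - (1 - 2 * \<alpha>) * inner v w - \<alpha> * inner w w"
    by (simp add: algebra_simps)
  then have "0 \<le> \<alpha> * ((1 - \<alpha>) * inner v v - (1 - 2 * \<alpha>) * inner v w - \<alpha> * inner w w)"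
    using \<alpha> by simp
  also have "\<dots> = inner (T x - T y) v - inner (T x - T y) (T x - T y)"
    unfolding u
    by (simp add: inner_add_left inner_add_right inner_commute[of w v] algebra_simps)
  finally show "(norm (T x - T y))\<^sup>2 \<le> inner (T x - T y) (x - y)"
    by (simp add: power2_norm_eq_inner v_def)
qed

lemma firmly_nonexpansive_imp_nonexpansive:
  assumes "firmly_nonexpansive T"
  shows "nonexpansive T"
  unfolding nonexpansive_def
proof (intro allI)
  fix x y
  have "norm (T x - T y) * norm (T x - T y) \<le> norm (T x - T y) * norm (x - y)"
    using assms norm_cauchy_schwarz[of "T x - T y" "x - y"] order_trans
    unfolding firmly_nonexpansive_def power2_eq_square by blast
  then show "norm (T x - T y) \<le> norm (x - y)"
    by (cases "T x = T y") auto
qed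

lemma nonexpansive_compose:
  assumes "nonexpansive S" and "nonexpansive T"
  shows "nonexpansive (S \<circ> T)"
  using assms order_trans unfolding nonexpansive_def comp_def by blast

text \<open>With \<open>u = T x - T y\<close> and \<open>v = x - y\<close>, the gap \<open>\<parallel>v\<parallel>\<^sup>2 - \<parallel>(1 + \<theta>) u - \<theta> v\<parallel>\<^sup>2\<close> is
  \<open>1 + \<theta>\<close> times \<open>(1 - \<theta>) \<parallel>v\<parallel>\<^sup>2 + 2 \<theta> \<langle>u, v\<rangle> - (1 + \<theta>) \<parallel>u\<parallel>\<^sup>2\<close>, where both \<open>\<parallel>v\<parallel>\<^sup>2\<close> and
  \<open>\<langle>u, v\<rangle>\<close> are at least \<open>\<parallel>u\<parallel>\<^sup>2\<close>. The extreme case \<open>\<theta> = 1\<close> is the reflection \<open>2 T - I\<close>.\<close>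

lemma nonexpansive_momentum_op:
  fixes T :: "'a::real_inner \<Rightarrow> 'a"
  assumes T: "firmly_nonexpansive T" and \<theta>: "0 \<le> \<theta>" "\<theta> \<le> 1"
  shows "nonexpansive (momentum_op T \<theta>)"
  unfolding nonexpansive_def
proof (intro allI)
  fix x y
  define u v where "u = T x - T y" and "v = x - y"
  have uv: "inner u u \<le> inner u v"
    using T unfolding firmly_nonexpansive_def u_def v_def by (simp add: power2_norm_eq_inner)
  have "norm u \<le> norm v"
    using firmly_nonexpansive_imp_nonexpansive[OF T]
    unfolding nonexpansive_def u_def v_def by blast
  then have vv: "inner u u \<le> inner v v"
    by (simp add: power_mono flip: power2_norm_eq_inner)
  have diff: "momentum_op T \<theta> x - momentum_op T \<theta> y = (1 + \<theta>) *\<^sub>R u - \<theta> *\<^sub>R v"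
    unfolding momentum_op_def u_def v_def by (simp add: algebra_simps)
  have "(1 - \<theta>) * inner u u \<le> (1 - \<theta>) * inner v v"
    using vv \<theta> by (intro mult_left_mono) auto
  moreover have "\<theta> * inner u u \<le> \<theta> * inner u v"
    using uv \<theta> by (intro mult_left_mono) auto
  ultimately have "0 \<le> (1 - \<theta>) * inner v v + 2 * \<theta> * inner u v - (1 + \<theta>) * inner u u"
    by (simp add: algebra_simps)
  then have "0 \<le> (1 + \<theta>) * ((1 - \<theta>) * inner v v + 2 * \<theta> * inner u v - (1 + \<theta>) * inner u u)"
    using \<theta> by simp
  also have "\<dots> = (norm v)\<^sup>2 - (norm ((1 + \<theta>) *\<^sub>R u - \<theta> *\<^sub>R v))\<^sup>2"
    unfolding power2_norm_eq_inner
    by (simp add: inner_diff_left inner_diff_right inner_commute[of v u] algebra_simps)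
  finally have "(norm ((1 + \<theta>) *\<^sub>R u - \<theta> *\<^sub>R v))\<^sup>2 \<le> (norm v)\<^sup>2" by simp
  then show "norm (momentum_op T \<theta> x - momentum_op T \<theta> y) \<le> norm (x - y)"
    unfolding diff v_def[symmetric] by (rule power2_le_imp_le) simp
qed

lemma firmly_nonexpansive_Fix:
  fixes T :: "'a::real_inner \<Rightarrow> 'a"
  assumes "firmly_nonexpansive T" and "p \<in> Fix T"
  shows "inner (T x - x) (T x - p) \<le> 0"
proof -
  have "T p = p" using assms(2) by (simp add: Fix_def)
  then have "inner (T x - p) (T x - p) \<le> inner (T x - p) (x - p)"
    using assms(1)[unfolded firmly_nonexpansive_def, rule_format, of x p]
    by (simp only: power2_norm_eq_inner)
  moreover have "inner (T x - x) (T x - p)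
      = inner (T x - p) (T x - p) - inner (T x - p) (x - p)"
    by (simp only: inner_commute[of "T x - x"] flip: inner_diff_right) simp
  ultimately show ?thesis by simp
qed

text \<open>The error \<open>T x + \<theta> (T x - x) - p\<close> exceeds the error \<open>T x - p\<close> by a multiple of the
  residual, whose inner product with \<open>T x - p\<close> is at most zero. So extrapolating by
  \<open>\<theta>\<close> costs at most \<open>\<theta>\<^sup>2 \<parallel>T x - x\<parallel>\<^sup>2\<close>. The case \<open>\<theta> = 0\<close> is the usual
  quantitative Fejer estimate for \<open>T\<close>.\<close>

lemma momentum_op_distance_to_Fix:
  fixes T :: "'a::real_inner \<Rightarrow> 'a"
  assumes T: "firmly_nonexpansive T" and p: "p \<in> Fix T" and \<theta>: "0 \<le> \<theta>"
  shows "(norm (momentum_op T \<theta> x - p))\<^sup>2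
    \<le> (norm (x - p))\<^sup>2 - (1 - \<theta>\<^sup>2) * (norm (T x - x))\<^sup>2"
proof -
  define e r where "e = T x - p" and "r = T x - x"
  have "inner r e \<le> 0"
    unfolding e_def r_def by (rule firmly_nonexpansive_Fix[OF T p])
  then have "(2 + 2 * \<theta>) * inner r e \<le> 0"
    using \<theta> by (simp add: mult_nonneg_nonpos)
  then have "(norm (e + \<theta> *\<^sub>R r))\<^sup>2 \<le> (norm (e - r))\<^sup>2 - (1 - \<theta>\<^sup>2) * (norm r)\<^sup>2"
    unfolding power2_norm_eq_inner
    by (simp add: inner_diff_left inner_diff_right inner_add_left inner_add_right
        inner_commute[of e r] power2_eq_square algebra_simps)
  moreover have "x - p = e - r" "momentum_op T \<theta> x - p = e + \<theta> *\<^sub>R r"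
    by (simp_all add: e_def r_def momentum_op_def)
  ultimately show ?thesis
    by (simp only: r_def)
qed

section \<open>One step of the TKMA iteration\<close>

definition tkma_op :: "('a::real_vector \<Rightarrow> 'a) \<Rightarrow> real \<Rightarrow> real \<Rightarrow> 'a \<Rightarrow> 'a" where
  "tkma_op T t \<theta> x = (1 - t) *\<^sub>R (T \<circ> T) x + t *\<^sub>R momentum_op T \<theta> x"

lemma nonexpansive_tkma_op:
  fixes T :: "'a::real_inner \<Rightarrow> 'a"
  assumes T: "firmly_nonexpansive T" and \<theta>: "0 \<le> \<theta>" "\<theta> \<le> 1" and t: "0 \<le> t" "t \<le> 1"
  shows "nonexpansive (tkma_op T t \<theta>)"
  unfolding nonexpansive_def
proof (intro allI)
  fix x y
  have T2: "norm ((T \<circ> T) x - (T \<circ> T) y) \<le> norm (x - y)"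
    using firmly_nonexpansive_imp_nonexpansive[OF T] nonexpansive_compose[of T T]
    unfolding nonexpansive_def by blast
  have M: "norm (momentum_op T \<theta> x - momentum_op T \<theta> y) \<le> norm (x - y)"
    using nonexpansive_momentum_op[OF T \<theta>] unfolding nonexpansive_def by blast
  have "tkma_op T t \<theta> x - tkma_op T t \<theta> y =
      (1 - t) *\<^sub>R ((T \<circ> T) x - (T \<circ> T) y) + t *\<^sub>R (momentum_op T \<theta> x - momentum_op T \<theta> y)"
    by (simp add: tkma_op_def algebra_simps)
  then have "norm (tkma_op T t \<theta> x - tkma_op T t \<theta> y)
      \<le> norm ((1 - t) *\<^sub>R ((T \<circ> T) x - (T \<circ> T) y))
        + norm (t *\<^sub>R (momentum_op T \<theta> x - momentum_op T \<theta> y))"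
    by (simp only: norm_triangle_ineq)
  also have "\<dots> = (1 - t) * norm ((T \<circ> T) x - (T \<circ> T) y)
      + t * norm (momentum_op T \<theta> x - momentum_op T \<theta> y)"
    using t by simp
  also have "\<dots> \<le> (1 - t) * norm (x - y) + t * norm (x - y)"
    using t by (intro add_mono mult_left_mono T2 M) auto
  finally show "norm (tkma_op T t \<theta> x - tkma_op T t \<theta> y) \<le> norm (x - y)"
    by (simp add: algebra_simps)
qed

lemma norm_convex_combination_square_le:
  fixes a b :: "'a::real_inner"
  assumes "0 \<le> t" "t \<le> 1"
  shows "(norm ((1 - t) *\<^sub>R a + t *\<^sub>R b))\<^sup>2 \<le> (1 - t) * (norm a)\<^sup>2 + t * (norm b)\<^sup>2"
proof -
  have "(1 - t) * (norm a)\<^sup>2 + t * (norm b)\<^sup>2 - (norm ((1 - t) *\<^sub>R a + t *\<^sub>R b))\<^sup>2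
      = t * (1 - t) * (norm (a - b))\<^sup>2"
    unfolding power2_norm_eq_inner
    by (simp add: inner_diff_left inner_diff_right inner_add_left inner_add_right
        inner_commute[of b a] algebra_simps)
  moreover have "0 \<le> t * (1 - t) * (norm (a - b))\<^sup>2" using assms by simp
  ultimately show ?thesis by linarith
qed

text \<open>The extrapolated point need not be closer to \<open>p\<close> when \<open>\<theta> = 1\<close>; the decrease is due to
  the component \<open>T\<^sup>2 x\<close>, which has the weight \<open>1 - t\<close>.\<close>

lemma tkma_op_distance_to_Fix:
  fixes T :: "'a::real_inner \<Rightarrow> 'a"
  assumes T: "firmly_nonexpansive T" and p: "p \<in> Fix T"
    and \<theta>: "0 \<le> \<theta>" "\<theta> \<le> 1" and t: "0 \<le> t" "t \<le> 1"
  shows "(norm (tkma_op T t \<theta> x - p))\<^sup>2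
    \<le> (norm (x - p))\<^sup>2 - (1 - t) * (norm (T x - x))\<^sup>2"
proof -
  have Tdist: "(norm (T z - p))\<^sup>2 \<le> (norm (z - p))\<^sup>2 - (norm (T z - z))\<^sup>2" for z
    using momentum_op_distance_to_Fix[OF T p, of 0 z] by (simp add: momentum_op_def)
  have T2: "(norm ((T \<circ> T) x - p))\<^sup>2 \<le> (norm (x - p))\<^sup>2 - (norm (T x - x))\<^sup>2"
    using Tdist[of x] Tdist[of "T x"] zero_le_power2[of "norm (T (T x) - T x)"]
    unfolding comp_def by linarith
  have "0 \<le> (1 - \<theta>\<^sup>2) * (norm (T x - x))\<^sup>2"
    using \<theta> by (simp add: power_le_one)
  then have M: "(norm (momentum_op T \<theta> x - p))\<^sup>2 \<le> (norm (x - p))\<^sup>2"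
    using momentum_op_distance_to_Fix[OF T p \<theta>(1), of x] by linarith
  have "tkma_op T t \<theta> x - p = (1 - t) *\<^sub>R ((T \<circ> T) x - p) + t *\<^sub>R (momentum_op T \<theta> x - p)"
    by (simp add: tkma_op_def algebra_simps)
  then have "(norm (tkma_op T t \<theta> x - p))\<^sup>2
      \<le> (1 - t) * (norm ((T \<circ> T) x - p))\<^sup>2 + t * (norm (momentum_op T \<theta> x - p))\<^sup>2"
    by (simp only: norm_convex_combination_square_le[OF t])
  also have "\<dots> \<le> (1 - t) * ((norm (x - p))\<^sup>2 - (norm (T x - x))\<^sup>2) + t * (norm (x - p))\<^sup>2"
    using t by (intro add_mono mult_left_mono T2 M) auto
  finally show ?thesis by (simp add: algebra_simps)
qed

text \<open>Firm nonexpansiveness at the pair \<open>x\<close>, \<open>T x\<close> says that the numerator of \<open>\<theta>\<close> is at least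
  the squared norm of the next residual, hence nonnegative; Cauchy--Schwarz bounds it by
  \<open>\<parallel>T x - x\<parallel>\<^sup>2\<close> because residuals do not grow along \<open>T\<close>.\<close>

lemma tkma_theta_bounds:
  fixes T :: "'a::real_inner \<Rightarrow> 'a"
  assumes T: "firmly_nonexpansive T"
  shows "0 \<le> tkma_theta T x" and "tkma_theta T x \<le> 1"
proof -
  define r s where "r = T x - x" and "s = T (T x) - T x"
  have \<theta>: "tkma_theta T x = inner r s / (norm r)\<^sup>2"
    unfolding tkma_theta_def r_def s_def comp_def
    by (simp flip: inner_minus_right)
  have "(norm s)\<^sup>2 \<le> inner s r"
    using T unfolding firmly_nonexpansive_def r_def s_def by blast
  then have "0 \<le> inner r s"
    using zero_le_power2[of "norm s"] unfolding inner_commute[of s r] by linarith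
  then show "0 \<le> tkma_theta T x" unfolding \<theta> by simp
  have "norm s \<le> norm r"
    using firmly_nonexpansive_imp_nonexpansive[OF T]
    unfolding nonexpansive_def r_def s_def by blast
  then have "norm r * norm s \<le> norm r * norm r"
    by (intro mult_left_mono) auto
  then have "inner r s \<le> (norm r)\<^sup>2"
    using norm_cauchy_schwarz[of r s] unfolding power2_eq_square by linarith
  then show "tkma_theta T x \<le> 1"
    unfolding \<theta> by (simp add: divide_le_eq_1)
qed

text \<open>With \<open>r = T x - x\<close> and \<open>s = T\<^sup>2 x - T x\<close> the displacement is \<open>(1 + t \<theta>) r + (1 - t) s\<close>.
  As \<open>\<langle>r, s\<rangle> \<ge> 0\<close>, the second term does not shorten the first.\<close>

lemma tkma_op_displacement_bounds:
  fixes T :: "'a::real_inner \<Rightarrow> 'a"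
  assumes T: "firmly_nonexpansive T" and \<theta>: "0 \<le> \<theta>" "\<theta> \<le> 1" and t: "0 \<le> t" "t \<le> 1"
  shows "norm (T x - x) \<le> norm (tkma_op T t \<theta> x - x)"
    and "norm (tkma_op T t \<theta> x - x) \<le> 2 * norm (T x - x)"
proof -
  define r s where "r = T x - x" and "s = T (T x) - T x"
  have disp: "tkma_op T t \<theta> x - x = (1 + t * \<theta>) *\<^sub>R r + (1 - t) *\<^sub>R s"
    unfolding tkma_op_def momentum_op_def r_def s_def comp_def
    by (simp add: algebra_simps)
  have "(norm s)\<^sup>2 \<le> inner s r"
    using T unfolding firmly_nonexpansive_def r_def s_def by blast
  then have rs: "0 \<le> inner r s"
    using zero_le_power2[of "norm s"] unfolding inner_commute[of s r] by linarith
  have sr: "norm s \<le> norm r"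
    using firmly_nonexpansive_imp_nonexpansive[OF T]
    unfolding nonexpansive_def r_def s_def by blast
  have "norm r * norm r \<le> (1 + t * \<theta>) * (norm r * norm r) + (1 - t) * inner r s"
  proof -
    have "0 \<le> t * \<theta> * (norm r * norm r)" and "0 \<le> (1 - t) * inner r s"
      using t \<theta> rs by simp_all
    then show ?thesis by (simp only: distrib_right)
  qed
  also have "\<dots> = inner r (tkma_op T t \<theta> x - x)"
    unfolding disp by (simp add: inner_add_right flip: power2_norm_eq_inner power2_eq_square)
  also have "\<dots> \<le> norm r * norm (tkma_op T t \<theta> x - x)"
    by (rule norm_cauchy_schwarz)
  finally have "norm r \<le> norm (tkma_op T t \<theta> x - x)"
    by (cases "r = 0") auto
  then show "norm (T x - x) \<le> norm (tkma_op T t \<theta> x - x)"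
    unfolding r_def .
  have "norm (tkma_op T t \<theta> x - x) \<le> norm ((1 + t * \<theta>) *\<^sub>R r) + norm ((1 - t) *\<^sub>R s)"
    unfolding disp by (rule norm_triangle_ineq)
  also have "\<dots> = (1 + t * \<theta>) * norm r + (1 - t) * norm s"
    using t \<theta> by simp
  also have "\<dots> \<le> (1 + t) * norm r + (1 - t) * norm r"
    using t \<theta> by (intro add_mono mult_right_mono mult_left_mono sr) (auto simp: mult_left_le)
  finally show "norm (tkma_op T t \<theta> x - x) \<le> 2 * norm (T x - x)"
    unfolding r_def by (simp add: algebra_simps)
qed

text \<open>Insert the point \<open>S\<^sub>\<eta> x\<close> between \<open>S\<^sub>\<eta> (S\<^sub>\<theta> x)\<close> and \<open>S\<^sub>\<theta> x\<close>, where \<open>S\<close> is the step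
  operator: the first distance is controlled by nonexpansiveness, the second is
  \<open>t \<bar>\<eta> - \<theta>\<bar> \<parallel>T x - x\<parallel>\<close>, which the displacement of the previous step dominates.\<close>

lemma tkma_op_displacement_growth:
  fixes T :: "'a::real_inner \<Rightarrow> 'a"
  assumes T: "firmly_nonexpansive T" and \<theta>: "0 \<le> \<theta>" "\<theta> \<le> 1"
    and \<eta>: "0 \<le> \<eta>" "\<eta> \<le> 1" and t: "0 \<le> t" "t \<le> 1"
    and y: "y = tkma_op T t \<theta> x"
  shows "norm (tkma_op T t \<eta> y - y) \<le> (1 + \<bar>\<eta> - \<theta>\<bar>) * norm (y - x)"
proof -
  have "norm (tkma_op T t \<eta> x - y) = t * \<bar>\<eta> - \<theta>\<bar> * norm (T x - x)"
  proof -
    have "tkma_op T t \<eta> x - y = (t * (\<eta> - \<theta>)) *\<^sub>R (T x - x)"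
      unfolding y tkma_op_def momentum_op_def by (simp add: algebra_simps)
    then show ?thesis using t by (simp add: abs_mult)
  qed
  also have "\<dots> \<le> 1 * \<bar>\<eta> - \<theta>\<bar> * norm (y - x)"
    using t tkma_op_displacement_bounds(1)[OF T \<theta> t, of x]
    unfolding y by (intro mult_mono) auto
  finally have shift: "norm (tkma_op T t \<eta> x - y) \<le> \<bar>\<eta> - \<theta>\<bar> * norm (y - x)" by simp
  have "norm (tkma_op T t \<eta> y - tkma_op T t \<eta> x) \<le> norm (y - x)"
    using nonexpansive_tkma_op[OF T \<eta> t] unfolding nonexpansive_def by blast
  then show ?thesis
    using shift norm_triangle_ineq[of "tkma_op T t \<eta> y - tkma_op T t \<eta> x" "tkma_op T t \<eta> x - y"]
    by (simp add: algebra_simps)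
qed

section \<open>The convergence rate\<close>

theorem theorem4p8:
  fixes T :: "'a::{real_inner, complete_space} \<Rightarrow> 'a"
    and \<alpha> t :: real and x0 :: 'a
    and x :: "nat \<Rightarrow> 'a" and \<theta> :: "nat \<Rightarrow> real"
  assumes "0 < \<alpha>" and "\<alpha> \<le> 1 / 2"
    and "averaged_nonexpansive \<alpha> T"
    and "Fix T \<noteq> {}"
    and "0 < t" and "t < 1"
    and "tkma_iteration T t x0 x \<theta>"
    and "\<And>k. T (x k) \<noteq> x k"
    and "summable (\<lambda>k. \<bar>\<theta> (Suc k) - \<theta> k\<bar>)"
  shows "(\<lambda>k. norm (x (Suc k) - x k)) \<in> o(\<lambda>k. 1 / sqrt (real k))"
proof -
  have T: "firmly_nonexpansive T"
    using assms(2,3) averaged_imp_firmly_nonexpansive by blast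
  have t: "0 \<le> t" "t \<le> 1" using assms(5,6) by auto
  have step: "x (Suc k) = tkma_op T t (\<theta> k) (x k)" for k
    using assms(7) unfolding tkma_iteration_def tkma_op_def by blast
  have "\<theta> k = tkma_theta T (x k)" for k
    using assms(7) unfolding tkma_iteration_def by blast
  then have \<theta>: "0 \<le> \<theta> k" "\<theta> k \<le> 1" for k
    using tkma_theta_bounds[OF T] by simp_all
  obtain p where p: "p \<in> Fix T" using assms(4) by blast
  define d where "d k = norm (x (Suc k) - x k)" for k

  define r2 where "r2 k = (norm (T (x k) - x k))\<^sup>2" for k
  have "summable (\<lambda>k. (1 - t) * r2 k)"
  proof (rule summableI_nonneg_bounded)
    fix n
    show "0 \<le> (1 - t) * r2 n" using t by (simp add: r2_def)
    have "(norm (x n - p))\<^sup>2 + (\<Sum>k<n. (1 - t) * r2 k) \<le> (norm (x 0 - p))\<^sup>2"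
    proof (induction n)
      case (Suc n)
      then show ?case
        using tkma_op_distance_to_Fix[OF T p \<theta> t, of n "x n"]
        unfolding step[symmetric] r2_def by simp
    qed simp
    then show "(\<Sum>k<n. (1 - t) * r2 k) \<le> (norm (x 0 - p))\<^sup>2"
      using zero_le_power2[of "norm (x n - p)"] by linarith
  qed
  then have "summable r2"
    using summable_mult_D[of "1 - t" r2] assms(6) by simp
  moreover have "(d k)\<^sup>2 \<le> 4 * r2 k" for k
    using power_mono[OF tkma_op_displacement_bounds(2)[OF T \<theta> t, of k "x k"], of 2]
    unfolding d_def r2_def step by (simp add: power_mult_distrib)
  ultimately have sum_d: "summable (\<lambda>k. (d k)\<^sup>2)"
    using summable_comparison_test'[OF summable_mult[of r2 4], of 0 "\<lambda>k. (d k)\<^sup>2"] by simp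

  define C where "C = exp (\<Sum>k. \<bar>\<theta> (Suc k) - \<theta> k\<bar>)"
  have "d (Suc k) \<le> (1 + \<bar>\<theta> (Suc k) - \<theta> k\<bar>) * d k" for k
    unfolding d_def step[of "Suc k"]
    by (rule tkma_op_displacement_growth[OF T \<theta> \<theta> t step])
  then have "d n \<le> C * d m" if "m \<le> n" for m n
    unfolding C_def using quasi_decreasing_if_summable_growth[OF assms(9) _ _ _ that, of d]
    by (simp add: d_def)
  then have quasi: "(d n)\<^sup>2 \<le> C\<^sup>2 * (d m)\<^sup>2" if "m \<le> n" for m n
    using power_mono[of "d n" "C * d m" 2] that by (simp add: power_mult_distrib d_def)

  have "(\<lambda>k. real k * (d k)\<^sup>2) \<longlonglongrightarrow> 0"
    by (rule summable_quasi_decreasing_imp_tendsto[OF sum_d _ quasi]) simp_all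
  then have "(\<lambda>k. sqrt (real k * (d k)\<^sup>2)) \<longlonglongrightarrow> 0"
    using tendsto_real_sqrt by fastforce
  then have "(\<lambda>k. d k / (1 / sqrt (real k))) \<longlonglongrightarrow> 0"
    by (simp add: real_sqrt_mult d_def mult.commute)
  then show ?thesis
    unfolding d_def
    by (intro smalloI_tendsto) (auto intro: eventually_sequentiallyI[of 1])
qed

end
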